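(* Let $k\ge1$ be an integer. Then the following $^*$congruences hold: 1. $J_k(0)$ is $^*$congruent to $T_k(0)$. 2. If $\mu\in\mathbb{C}$ and $|\mu|=1$, then $\mu\Gamma_k$ is $^*$congruent to $\mu\widetilde\Gamma_k$ if $k\equiv1,2\pmod4$, and to $-\mu\widetilde\Gamma_k$ if $k\equiv0,3\pmod4$. 3. If $\mu\in\mathbb{C}$ and $|\mu|>1$, then $H_{2k}(\mu)$ is $^*$congruent to $T_{2k}(\mu)$.
   Context: Two matrices $A,B\in\mathbb{C}^{n\times n}$ are $^*$congruent if there is an invertible $S\in\mathbb{C}^{n\times n}$ with $SAS^*=B$, where $S^*$ is the conjugate transpose. For integers $k\ge1$ and $\mu\in\mathbb{C}$: $J_k(\mu)$ is the $k\times k$ upper triangular Jordan block with $\mu$ on the diagonal and $1$ on the superdiagonal. $\Gamma_k$ is the $k\times k$ matrix whose only nonzero entries are $(\Gamma_k)_{r,\,k+1-r}=(-1)^{k-r}$ for $1\le r\le k$ and $(\Gamma_k)_{r,\,k+2-r}=(-1)^{k-r}$ for $2\le r\le k$. So $\Gamma_1=1$, $\Gamma_2=\begin{bmatrix} 0 & -1 \\ 1 & 1 \end{bmatrix}$, $\Gamma_3=\begin{bmatrix} 0 & 0 & 1 \\ 0 & -1 & -1 \\ 1 & 1 & 0 \end{bmatrix}$. $H_{2k}(\mu)=\begin{bmatrix} 0 & I_k \\ J_k(\mu) & 0 \end{bmatrix}$. $T_k(\mu)$ is the $k\times k$ tridiagonal matrix with zero diagonal, all superdiagonal entries equal to $1$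 and all subdiagonal entries equal to $\mu$ ($T_1(\mu)=0$). $\widetilde\Gamma_k$ is the $k\times k$ tridiagonal matrix with $(1,1)$ entry equal to $1$, all other diagonal entries $0$, all superdiagonal entries equal to $1$, and subdiagonal entries $(\widetilde\Gamma_k)_{i+1,i}=(-1)^i$, $i=1,\dots,k-1$ ($\widetilde\Gamma_1=1$). *)

theory Defs
  imports "Jordan_Normal_Form.Schur_Decomposition" "Jordan_Normal_Form.Jordan_Normal_Form"
begin

definition star_congruent :: "nat \<Rightarrow> complex mat \<Rightarrow> complex mat \<Rightarrow> bool" where
  "star_congruent n A B \<longleftrightarrow>
     A \<in> carrier_mat n n \<and> B \<in> carrier_mat n n \<and>
     (\<exists>S \<in> carrier_mat n n. invertible_mat S \<and> S * A * mat_adjoint S = B)"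

text \<open>Matrix indices start at \<open>0\<close>: the entry in row \<open>r\<close> and column \<open>c\<close> of a matrix on paper has
  index \<open>(r - 1, c - 1)\<close>. So \<open>c = k + 1 - r\<close> becomes \<open>i + j + 1 = k\<close>, \<open>c = k + 2 - r\<close> becomes
  \<open>i + j = k\<close> (which forces \<open>r \<ge> 2\<close>), and the sign \<open>(-1)^(k - r)\<close> becomes \<open>(-1)^(k - 1 - i)\<close>.\<close>

definition Gamma_mat :: "nat \<Rightarrow> complex mat" where
  "Gamma_mat k = mat k k (\<lambda>(i, j).
     if i + j + 1 = k \<or> i + j = k then (-1) ^ (k - 1 - i) else 0)"

definition H_mat :: "nat \<Rightarrow> complex \<Rightarrow> complex mat" where
  "H_mat k \<mu> = four_block_mat (0\<^sub>m k k) (1\<^sub>m k) (jordan_block k \<mu>) (0\<^sub>m k k)"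
  \<comment> \<open>the matrix written \<open>H_{2k}\<close> on paper: the argument is half the size\<close>

definition T_mat :: "nat \<Rightarrow> complex \<Rightarrow> complex mat" where
  "T_mat k \<mu> = mat k k (\<lambda>(i, j).
     if j = i + 1 then 1 else if i = j + 1 then \<mu> else 0)"

definition Gamma_tilde_mat :: "nat \<Rightarrow> complex mat" where
  "Gamma_tilde_mat k = mat k k (\<lambda>(i, j).
     if i = 0 \<and> j = 0 then 1
     else if j = i + 1 then 1
     else if i = j + 1 then (-1) ^ (j + 1)
     else 0)"

end

theory Submission
  imports Defs
begin

text \<open>For the first part the two matrices coincide. For the second, the nonzero entries of
  \<open>\<Gamma>\<^sub>k\<close> link the indices in a path that starts with a loop at index \<open>k div 2\<close>; listing the indices
  along this path turns \<open>\<Gamma>\<^sub>k\<close> into a tridiagonal matrix whose signs are then adjusted by a diagonal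
  matrix. For the third, listing even indices before odd ones turns \<open>T\<^sub>2\<^sub>k(\<mu>)\<close> into the block matrix
  with off-diagonal blocks \<open>B\<^sup>*\<close> and \<open>J\<^sub>k(\<mu>)\<close>, where \<open>B = I + cnj \<mu> U\<close> and \<open>U\<close> is the nilpotent upper
  shift. Because \<open>\<bar>\<mu>\<bar> \<noteq> 1\<close>, the matrix \<open>J\<^sub>k(\<mu>) B\<^sup>-\<^sup>1\<close> is again similar to a single Jordan block with
  eigenvalue \<open>\<mu>\<close>, and a similarity \<open>Q\<close> yields the congruence \<open>(Q B)\<^sup>* \<oplus> Q\<^sup>-\<^sup>1\<close>.\<close>

section \<open>Conjugate transposes\<close>

lemma mat_adjoint_carrier [simp]:
  "A \<in> carrier_mat m n \<Longrightarrow> mat_adjoint A \<in> carrier_mat n m"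
  unfolding mat_adjoint_def by auto

lemma dim_mat_adjoint [simp]:
  "dim_row (mat_adjoint A) = dim_col A" "dim_col (mat_adjoint A) = dim_row A"
  unfolding mat_adjoint_def by auto

lemma index_mat_adjoint [simp]:
  fixes A :: "complex mat"
  assumes "i < dim_col A" "j < dim_row A"
  shows "mat_adjoint A $$ (i, j) = cnj (A $$ (j, i))"
  using assms unfolding mat_adjoint_def by (simp add: mat_of_rows_index)

lemma mat_adjoint_mult:
  fixes A B :: "complex mat"
  assumes "A \<in> carrier_mat m n" "B \<in> carrier_mat n l"
  shows "mat_adjoint (A * B) = mat_adjoint B * mat_adjoint A"
  using assms by (intro eq_matI) (auto simp: scalar_prod_def mult.commute)

lemma mat_adjoint_one [simp]: "mat_adjoint (1\<^sub>m n :: complex mat) = 1\<^sub>m n"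
  by (intro eq_matI) auto

lemma mat_adjoint_adjoint [simp]: "mat_adjoint (mat_adjoint A) = (A :: complex mat)"
  by (intro eq_matI) auto

lemma mat_adjoint_four_block_diag:
  fixes A D :: "complex mat"
  assumes "A \<in> carrier_mat n n" "D \<in> carrier_mat m m"
  shows "mat_adjoint (four_block_mat A (0\<^sub>m n m) (0\<^sub>m m n) D)
    = four_block_mat (mat_adjoint A) (0\<^sub>m n m) (0\<^sub>m m n) (mat_adjoint D)"
  using assms by (intro eq_matI) auto

section \<open>Invertible matrices over a field\<close>

lemma invertible_matI:
  fixes A :: "'a::field mat"
  assumes "A \<in> carrier_mat n n" "B \<in> carrier_mat n n" "A * B = 1\<^sub>m n"
  shows "invertible_mat A"
  using assms mat_mult_left_right_inverse[OF assms]
  unfolding invertible_mat_def inverts_mat_def by auto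

lemma invertible_matE:
  fixes A :: "'a::field mat"
  assumes "invertible_mat A" "A \<in> carrier_mat n n"
  obtains B where "B \<in> carrier_mat n n" "A * B = 1\<^sub>m n" "B * A = 1\<^sub>m n"
proof -
  from assms obtain B where AB: "A * B = 1\<^sub>m n" and BA: "B * A = 1\<^sub>m (dim_row B)"
    unfolding invertible_mat_def inverts_mat_def by auto
  \<comment> \<open>The inverse comes without a stated size; comparing column counts in
    \<open>A * B = 1\<^sub>m n\<close> and in \<open>B * A = 1\<^sub>m (dim_row B)\<close> shows
    that it is square of size \<open>n\<close>.\<close>
  have "B \<in> carrier_mat n n"
    using arg_cong[OF AB, of dim_col] arg_cong[OF BA, of dim_col] assms(2) by auto
  with AB BA that show thesis by auto
qed

lemma invertible_mat_mult:
  fixes A B :: "'a::field mat"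
  assumes A: "A \<in> carrier_mat n n" "invertible_mat A"
    and B: "B \<in> carrier_mat n n" "invertible_mat B"
  shows "invertible_mat (A * B)"
proof -
  obtain A' where A': "A' \<in> carrier_mat n n" "A * A' = 1\<^sub>m n"
    using invertible_matE A by blast
  obtain B' where B': "B' \<in> carrier_mat n n" "B * B' = 1\<^sub>m n"
    using invertible_matE B by blast
  have "A * B * (B' * A') = A * (B * (B' * A'))"
    using A B A' B' by (intro assoc_mult_mat) auto
  also have "B * (B' * A') = B * B' * A'"
    using A B A' B' by (intro assoc_mult_mat[symmetric]) auto
  finally have "A * B * (B' * A') = 1\<^sub>m n"
    using A' B' by simp
  then show ?thesis
    using A B A' B' by (intro invertible_matI[of _ n "B' * A'"]) auto
qed

text \<open>The determinant is the product of the nonzero diagonal entries.\<close>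

lemma invertible_upper_triangular:
  fixes A :: "'a::field mat"
  assumes A: "A \<in> carrier_mat n n" and ut: "upper_triangular A"
    and diag: "\<And>i. i < n \<Longrightarrow> A $$ (i, i) \<noteq> 0"
  shows "invertible_mat A"
proof -
  have "det A \<noteq> 0"
    using det_upper_triangular[OF ut A] A diag by (auto simp: prod_list_zero_iff diag_mat_def)
  from det_non_zero_imp_unit[OF A this, of undefined] show ?thesis
    using A by (auto simp: Units_def ring_mat_def intro: invertible_matI)
qed

section \<open>General rules for congruence; monomial transformations\<close>

lemma star_congruent_trans:
  assumes "star_congruent n A B" "star_congruent n B C"
  shows "star_congruent n A C"
proof -
  from assms obtain S R where A: "A \<in> carrier_mat n n"
    and S: "S \<in> carrier_mat n n" "invertible_mat S" "S * A * mat_adjoint S = B"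
    and R: "R \<in> carrier_mat n n" "invertible_mat R" "R * B * mat_adjoint R = C"
    and C: "C \<in> carrier_mat n n"
    unfolding star_congruent_def by auto
  have "R * S * A * mat_adjoint (R * S) = R * S * A * (mat_adjoint S * mat_adjoint R)"
    using R S by (simp add: mat_adjoint_mult)
  also have "\<dots> = R * (S * A * mat_adjoint S) * mat_adjoint R"
    using A R(1) S(1) by (simp add: assoc_mult_mat[of _ n n _ n _ n] mult_carrier_mat[of _ n n _ n])
  also have "\<dots> = C"
    using S R by simp
  finally show ?thesis
    using A C R S invertible_mat_mult[of R n S] unfolding star_congruent_def
    by (intro conjI bexI[of _ "R * S"]) auto
qed

text \<open>The transforming matrix is monomial: row \<open>i\<close> has the single nonzero entry
  \<open>d i\<close>, in column \<open>p i\<close>. This covers both plain reorderings of the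
  indices and reorderings with sign changes.\<close>

lemma star_congruent_monomial:
  fixes p :: "nat \<Rightarrow> nat" and d :: "nat \<Rightarrow> complex"
  assumes A: "A \<in> carrier_mat n n" and p: "bij_betw p {..<n} {..<n}"
    and d: "\<And>i. i < n \<Longrightarrow> d i \<noteq> 0"
  shows "star_congruent n A (mat n n (\<lambda>(i, j). d i * cnj (d j) * A $$ (p i, p j)))"
proof -
  define S where "S = mat n n (\<lambda>(i, j). if j = p i then d i else 0)"
  \<comment> \<open>The inverse of \<open>S\<close>: transposed pattern, reciprocal entries.\<close>
  define R where "R = mat n n (\<lambda>(i, j). if i = p j then 1 / d j else 0)"
  have S: "S \<in> carrier_mat n n" and R: "R \<in> carrier_mat n n"
    by (auto simp: S_def R_def)
  have p_less: "p i < n" if "i < n" for i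
    using p that by (auto simp: bij_betw_def)
  have p_inj: "p i = p j \<longleftrightarrow> i = j" if "i < n" "j < n" for i j
    using p that by (auto simp: bij_betw_def inj_on_def)
  \<comment> \<open>Stated for arbitrary \<open>X\<close> because it is applied both to
    \<open>R\<close> and to \<open>A * mat_adjoint S\<close>.\<close>
  have row: "(S * X) $$ (i, j) = d i * X $$ (p i, j)"
    if "X \<in> carrier_mat n n" "i < n" "j < n" for X i j
  proof -
    have "(S * X) $$ (i, j) = (\<Sum>l = 0..<n. S $$ (i, l) * X $$ (l, j))"
      using that S by (simp add: scalar_prod_def)
    also have "\<dots> = (\<Sum>l = 0..<n. if l = p i then d i * X $$ (l, j) else 0)"
      using that by (intro sum.cong) (auto simp: S_def)
    finally show ?thesis
      using p_less[OF that(2)] by simp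
  qed
  have "S * R = 1\<^sub>m n"
  proof (rule eq_matI)
    fix i j assume "i < dim_row (1\<^sub>m n :: complex mat)" "j < dim_col (1\<^sub>m n :: complex mat)"
    then have ij: "i < n" "j < n" by auto
    show "(S * R) $$ (i, j) = 1\<^sub>m n $$ (i, j)"
      unfolding row[OF R ij] using ij d p_less by (auto simp: R_def p_inj)
  qed (use S R in auto)
  then have "invertible_mat S"
    by (rule invertible_matI[OF S R])
  moreover have "S * A * mat_adjoint S = mat n n (\<lambda>(i, j). d i * cnj (d j) * A $$ (p i, p j))"
    (is "_ = ?M")
  proof (rule eq_matI)
    fix i j assume "i < dim_row ?M" "j < dim_col ?M"
    then have ij: "i < n" "j < n" by auto
    have "(S * A * mat_adjoint S) $$ (i, j) = (S * (A * mat_adjoint S)) $$ (i, j)"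
      using S A by (simp add: assoc_mult_mat[of _ n n _ n _ n])
    also have "\<dots> = d i * (A * mat_adjoint S) $$ (p i, j)"
      using S A ij by (intro row) auto
    also have "(A * mat_adjoint S) $$ (p i, j) = (\<Sum>l = 0..<n. A $$ (p i, l) * cnj (S $$ (j, l)))"
      using A S ij p_less by (simp add: scalar_prod_def)
    also have "\<dots> = (\<Sum>l = 0..<n. if l = p j then A $$ (p i, l) * cnj (d j) else 0)"
      using ij by (intro sum.cong) (auto simp: S_def)
    also have "\<dots> = A $$ (p i, p j) * cnj (d j)"
      using p_less ij by simp
    finally show "(S * A * mat_adjoint S) $$ (i, j) = ?M $$ (i, j)"
      using ij by simp
  qed (use S in auto)
  ultimately show ?thesis
    using A S unfolding star_congruent_def by auto
qed

lemma star_congruent_permutation: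
  assumes "A \<in> carrier_mat n n" "bij_betw p {..<n} {..<n}"
  shows "star_congruent n A (mat n n (\<lambda>(i, j). A $$ (p i, p j)))"
  using star_congruent_monomial[OF assms, of "\<lambda>_. 1"] by simp

lemma bij_betw_lessThanI:
  fixes p :: "nat \<Rightarrow> nat"
  assumes "\<And>i. i < n \<Longrightarrow> p i < n" "\<And>i j. i < n \<Longrightarrow> j < n \<Longrightarrow> p i = p j \<Longrightarrow> i = j"
  shows "bij_betw p {..<n} {..<n}"
proof -
  have "inj_on p {..<n}" "p ` {..<n} \<subseteq> {..<n}"
    using assms by (auto simp: inj_on_def)
  then show ?thesis
    by (simp add: bij_betw_def endo_inj_surj)
qed

lemma star_congruent_smult:
  assumes "star_congruent n A B"
  shows "star_congruent n (c \<cdot>\<^sub>m A) (c \<cdot>\<^sub>m B)"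
proof -
  from assms obtain S where A: "A \<in> carrier_mat n n" and B: "B \<in> carrier_mat n n"
    and S: "S \<in> carrier_mat n n" "invertible_mat S" "S * A * mat_adjoint S = B"
    unfolding star_congruent_def by auto
  have "S * (c \<cdot>\<^sub>m A) * mat_adjoint S = c \<cdot>\<^sub>m (S * A * mat_adjoint S)"
    using A S(1)
    by (simp add: mult_smult_distrib[of _ n n _ n] mult_smult_assoc_mat[of _ n n _ n])
  then show ?thesis
    using A B S unfolding star_congruent_def by auto
qed

lemma smult_smult_mat: "a \<cdot>\<^sub>m (b \<cdot>\<^sub>m A) = (a * b :: 'a::semigroup_mult) \<cdot>\<^sub>m A"
  by (intro eq_matI) (auto simp: mult.assoc)

lemma star_congruent_refl:
  assumes "A \<in> carrier_mat n n"
  shows "star_congruent n A A"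
proof -
  have "mat n n (\<lambda>(i, j). A $$ (i, j)) = A"
    using assms by (intro eq_matI) auto
  with star_congruent_permutation[OF assms, of "\<lambda>i. i"] show ?thesis
    by (simp add: bij_betw_def)
qed

lemma jordan_block_zero_eq_T_mat: "jordan_block k 0 = T_mat k 0"
  by (intro eq_matI) (auto simp: T_mat_def)

subsection \<open>The unimodular case\<close>

text \<open>The path zigzags outward from \<open>k div 2\<close>, applying the reflections of
  \<open>x\<close> to \<open>k - x\<close> and to \<open>k - 1 - x\<close> in turn. Even
  \<open>k + i\<close> gives the indices in the upper half, odd \<open>k + i\<close> those in the
  lower half; the last index visited is 0.\<close>

definition Gamma_path :: "nat \<Rightarrow> nat \<Rightarrow> nat" where
  "Gamma_path k i = (if even (k + i) then (k + i) div 2 else (k - 1 - i) div 2)"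

lemma bij_betw_Gamma_path: "bij_betw (Gamma_path k) {..<k} {..<k}"
proof (rule bij_betw_lessThanI)
  show "Gamma_path k i < k" if "i < k" for i
    using that unfolding Gamma_path_def by auto
  show "i = j" if "i < k" "j < k" "Gamma_path k i = Gamma_path k j" for i j
    using that unfolding Gamma_path_def by (auto split: if_splits elim!: evenE oddE)
qed

text \<open>Doubling removes the divisions: twice a path index is \<open>k + i\<close> or
  \<open>k - 1 - i\<close>, depending on the parity of \<open>k + i\<close>. Two steps of equal
  parity can only meet in the loop at the start; steps of opposite parity are linked exactly when
  they are consecutive.\<close>

lemma Gamma_path_adjacent:
  assumes "i < k" "j < k"
  shows "(Gamma_path k i + Gamma_path k j + 1 = k \<or> Gamma_path k i + Gamma_path k j = k)
    \<longleftrightarrow> j = i + 1 \<or> i = j + 1 \<or> (i = 0 \<and> j = 0)"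
proof -
  let ?p = "Gamma_path k i" and ?q = "Gamma_path k j"
  have even: "2 * Gamma_path k l = k + l" if "even (k + l)" for l
    using that unfolding Gamma_path_def by simp
  have odd: "2 * Gamma_path k l + l + 1 = k" if "odd (k + l)" "l < k" for l
    using that unfolding Gamma_path_def by (auto elim!: oddE)
  consider "even (k + i)" "even (k + j)" | "even (k + i)" "odd (k + j)"
    | "odd (k + i)" "even (k + j)" | "odd (k + i)" "odd (k + j)"
    by blast
  then show ?thesis
  proof cases
    case 1
    note half = even[OF 1(1)] even[OF 1(2)]
    have "?p + ?q + 1 \<noteq> k" "?p + ?q = k \<longleftrightarrow> i + j = 0"
      using half by auto
    moreover have "j \<noteq> i + 1" "i \<noteq> j + 1"
      using 1 by auto
    ultimately show ?thesis by auto
  next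
    case 2
    note half = even[OF 2(1)] odd[OF 2(2) assms(2)]
    have "?p + ?q + 1 = k \<longleftrightarrow> j = i + 1" "?p + ?q = k \<longleftrightarrow> i = j + 1"
      using half by auto
    moreover have "\<not> (i = 0 \<and> j = 0)"
      using 2 by (intro notI) simp
    ultimately show ?thesis by auto
  next
    case 3
    note half = odd[OF 3(1) assms(1)] even[OF 3(2)]
    have "?p + ?q + 1 = k \<longleftrightarrow> i = j + 1" "?p + ?q = k \<longleftrightarrow> j = i + 1"
      using half by auto
    moreover have "\<not> (i = 0 \<and> j = 0)"
      using 3 by (intro notI) simp
    ultimately show ?thesis by auto
  next
    case 4
    note half = odd[OF 4(1) assms(1)] odd[OF 4(2) assms(2)]
    have "?p + ?q + 1 = k \<longleftrightarrow> i + j = 0" "?p + ?q \<noteq> k"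
      using half by auto
    moreover have "j \<noteq> i + 1" "i \<noteq> j + 1"
      using 4 by auto
    ultimately show ?thesis by auto
  qed
qed

text \<open>Consecutive path indices lie at distance exactly \<open>i + 1\<close>, so the
  alternating row sign changes by the factor that stands on the subdiagonal of
  \<open>Gamma_tilde_mat\<close>.\<close>

lemma Gamma_path_sign:
  assumes "Suc i < k"
  shows "(-1 :: complex) ^ (k - 1 - Gamma_path k (Suc i))
    = (-1) ^ (i + 1) * (-1) ^ (k - 1 - Gamma_path k i)"
proof -
  have "Gamma_path k i = Gamma_path k (Suc i) + (i + 1)
      \<or> Gamma_path k (Suc i) = Gamma_path k i + (i + 1)"
    using assms unfolding Gamma_path_def
    by (cases "even k"; cases "even i") (auto elim!: evenE oddE)
  moreover have "Gamma_path k i < k" "Gamma_path k (Suc i) < k"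
    using assms bij_betw_Gamma_path[of k] by (auto simp: bij_betw_def)
  ultimately have "k - 1 - Gamma_path k (Suc i) = (k - 1 - Gamma_path k i) + (i + 1)
      \<or> k - 1 - Gamma_path k i = (k - 1 - Gamma_path k (Suc i)) + (i + 1)"
    by linarith
  \<comment> \<open>Which of the two indices is larger depends on the parity of
    \<open>k + i\<close>, but the parity of their distance does not.\<close>
  moreover have "even a \<longleftrightarrow> even (i + 1 + b)" if "a = b + (i + 1) \<or> b = a + (i + 1)" for a b
    using that by auto
  ultimately have "even (k - 1 - Gamma_path k (Suc i)) \<longleftrightarrow> even (i + 1 + (k - 1 - Gamma_path k i))"
    by blast
  then show ?thesis
    by (simp add: minus_one_power_iff flip: power_add)
qed

text \<open>The scalar is the sign of the loop entry in row \<open>k div 2\<close>: the diagonal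
  scaling multiplies that entry by \<open>d 0 * cnj (d 0) = 1\<close>, and
  \<open>Gamma_tilde_mat\<close> has 1 in that place.\<close>

lemma star_congruent_Gamma_mat:
  assumes k: "k \<ge> 1"
  shows "star_congruent k (Gamma_mat k) ((-1) ^ (k - 1 - k div 2) \<cdot>\<^sub>m Gamma_tilde_mat k)"
proof -
  define s where "s i = (-1 :: complex) ^ (k - 1 - Gamma_path k i)" for i
  define \<epsilon> where "\<epsilon> = (-1 :: complex) ^ (k - 1 - k div 2)"
  \<comment> \<open>The superdiagonal must become \<epsilon>, that is,
    \<open>d i * d (Suc i) * s i = \<epsilon>\<close>. As all factors are signs, this can be solved
    for \<open>d (Suc i)\<close>.\<close>
  define d where "d = rec_nat (1 :: complex) (\<lambda>i x. \<epsilon> * s i * x)"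
  have d_0: "d 0 = 1" and d_Suc: "d (Suc i) = \<epsilon> * s i * d i" for i
    by (simp_all add: d_def)
  have sq: "s i * s i = 1" "\<epsilon> * \<epsilon> = 1" for i
    by (simp_all add: s_def \<epsilon>_def flip: power_add)
  have d_sq: "d i * d i = 1" for i
  proof (induction i)
    case (Suc i)
    have "d (Suc i) * d (Suc i) = (\<epsilon> * \<epsilon>) * (s i * s i) * (d i * d i)"
      by (simp add: d_Suc mult_ac)
    with Suc sq show ?case by simp
  qed (simp add: d_0)
  have cnj_d: "cnj (d i) = d i" for i
    by (induction i) (simp_all add: d_0 d_Suc \<epsilon>_def s_def)
  have step: "d i * d (Suc i) * s i = \<epsilon>" for i
  proof -
    have "d i * d (Suc i) * s i = \<epsilon> * (s i * s i) * (d i * d i)"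
      by (simp add: d_Suc mult_ac)
    with sq d_sq show ?thesis by simp
  qed
  have start: "s 0 = \<epsilon>"
  proof -
    have "Gamma_path k 0 = k div 2"
      unfolding Gamma_path_def by presburger
    then show ?thesis
      by (simp add: s_def \<epsilon>_def)
  qed
  have path_less: "Gamma_path k i < k" if "i < k" for i
    using bij_betw_Gamma_path[of k] that by (auto simp: bij_betw_def)
  have entry: "Gamma_mat k $$ (Gamma_path k i, Gamma_path k j)
      = (if j = i + 1 \<or> i = j + 1 \<or> (i = 0 \<and> j = 0) then s i else 0)" if "i < k" "j < k" for i j
    using that path_less Gamma_path_adjacent[OF that] by (simp add: Gamma_mat_def s_def)
  have "star_congruent k (Gamma_mat k)
      (mat k k (\<lambda>(i, j). d i * cnj (d j) * Gamma_mat k $$ (Gamma_path k i, Gamma_path k j)))"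
    using d_sq by (intro star_congruent_monomial bij_betw_Gamma_path)
      (auto simp: Gamma_mat_def, metis mult_zero_left zero_neq_one)
  also have "mat k k (\<lambda>(i, j). d i * cnj (d j) * Gamma_mat k $$ (Gamma_path k i, Gamma_path k j))
      = \<epsilon> \<cdot>\<^sub>m Gamma_tilde_mat k" (is "?L = ?R")
  proof (rule eq_matI)
    fix i j assume "i < dim_row ?R" "j < dim_col ?R"
    then have ij: "i < k" "j < k"
      by (auto simp: Gamma_tilde_mat_def)
    have L: "?L $$ (i, j)
        = d i * d j * (if j = i + 1 \<or> i = j + 1 \<or> (i = 0 \<and> j = 0) then s i else 0)"
      using ij by (simp add: entry cnj_d)
    consider "j = Suc i" | "i = Suc j" | "i = 0" "j = 0"
      | "\<not> (j = i + 1 \<or> i = j + 1 \<or> (i = 0 \<and> j = 0))"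
      by auto
    then show "?L $$ (i, j) = ?R $$ (i, j)"
    proof cases
      case 1
      with L step[of i] ij show ?thesis
        by (simp add: Gamma_tilde_mat_def)
    next
      case 2
      \<comment> \<open>The subdiagonal entry carries the sign of its own row \<open>Suc j\<close>;
        rewriting that sign through \<open>s j\<close> reduces the claim to the superdiagonal
        identity \<open>step\<close>.\<close>
      have "s i = (-1) ^ (j + 1) * s j"
        using Gamma_path_sign[of j k] ij 2 by (simp add: s_def)
      then have "d i * d j * s i = (-1) ^ (j + 1) * (d j * d (Suc j) * s j)"
        using 2 by (simp add: mult_ac)
      moreover have "?R $$ (i, j) = (-1) ^ (j + 1) * \<epsilon>"
        using 2 ij by (simp add: Gamma_tilde_mat_def)
      ultimately show ?thesis
        unfolding L using 2 step[of j] by simp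
    next
      case 3
      with L ij show ?thesis
        by (simp add: Gamma_tilde_mat_def d_0 start)
    next
      case 4
      with L ij show ?thesis
        by (auto simp: Gamma_tilde_mat_def)
    qed
  qed (auto simp: Gamma_tilde_mat_def)
  finally show ?thesis
    by (simp add: \<epsilon>_def)
qed

lemma even_sign_exponent_iff:
  assumes "(k::nat) \<ge> 1"
  shows "even (k - 1 - k div 2) \<longleftrightarrow> k mod 4 \<in> {1, 2}"
proof -
  define q r where "q = k div 4" and "r = k mod 4"
  have k: "k = 4 * q + r"
    unfolding q_def r_def by (rule mult_div_mod_eq[symmetric])
  have "r < 4"
    by (simp add: r_def)
  then consider "r = 0" | "r = 1" | "r = 2" | "r = 3"
    by linarith
  then show ?thesis
  proof cases
    case 1
    \<comment> \<open>The exponent is \<open>2 * q - 1\<close>; here \<open>q\<close> is positive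
      because \<open>k\<close> is, so the truncated subtraction is exact.\<close>
    with k assms have "k - 1 - k div 2 = 2 * (q - 1) + 1"
      by auto
    then show ?thesis
      using 1 r_def by simp
  next
    case 2
    with k have "k - 1 - k div 2 = 2 * q"
      by auto
    then show ?thesis
      using 2 r_def by simp
  next
    case 3
    with k have "k - 1 - k div 2 = 2 * q"
      by auto
    then show ?thesis
      using 3 r_def by simp
  next
    case 4
    with k have "k - 1 - k div 2 = 2 * q + 1"
      by auto
    then show ?thesis
      using 4 r_def by simp
  qed
qed

subsection \<open>The case of modulus greater than one\<close>

text \<open>The matrix \<open>d I + e U\<close> with \<open>U\<close> the upper shift. It covers
  both the Jordan block and the factor \<open>B\<close>, so one pair of product rules serves for
  both.\<close>

definition bidiag_mat :: "nat \<Rightarrow> 'a \<Rightarrow> 'a \<Rightarrow> 'a::semiring_1 mat" where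
  "bidiag_mat k d e = mat k k (\<lambda>(i, j). if i = j then d else if Suc i = j then e else 0)"

lemma bidiag_mat_carrier [simp]: "bidiag_mat k d e \<in> carrier_mat k k"
  by (simp add: bidiag_mat_def)

lemma dim_bidiag_mat [simp]: "dim_row (bidiag_mat k d e) = k" "dim_col (bidiag_mat k d e) = k"
  by (simp_all add: bidiag_mat_def)

lemma jordan_block_eq_bidiag_mat: "jordan_block k d = bidiag_mat k d 1"
  by (intro eq_matI) (auto simp: bidiag_mat_def)

lemma index_mult_bidiag_mat:
  fixes A :: "'a::comm_ring_1 mat"
  assumes "A \<in> carrier_mat k k" "i < k" "j < k"
  shows "(A * bidiag_mat k d e) $$ (i, j)
    = d * A $$ (i, j) + (if j = 0 then 0 else e * A $$ (i, j - 1))"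
proof -
  have "(A * bidiag_mat k d e) $$ (i, j) = (\<Sum>l = 0..<k. A $$ (i, l) * bidiag_mat k d e $$ (l, j))"
    using assms by (simp add: scalar_prod_def)
  also have "\<dots> = (\<Sum>l = 0..<k. (if l = j then d * A $$ (i, l) else 0)
      + (if Suc l = j then e * A $$ (i, l) else 0))"
    using assms by (intro sum.cong) (auto simp: bidiag_mat_def mult.commute)
  also have "\<dots> = d * A $$ (i, j) + (\<Sum>l = 0..<k. if Suc l = j then e * A $$ (i, l) else 0)"
    using assms by (simp add: sum.distrib)
  also have "(\<Sum>l = 0..<k. if Suc l = j then e * A $$ (i, l) else 0)
      = (if j = 0 then 0 else e * A $$ (i, j - 1))"
    using assms by (cases j) auto
  finally show ?thesis .
qed

lemma index_bidiag_mat_mult: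
  fixes A :: "'a::comm_ring_1 mat"
  assumes "A \<in> carrier_mat k k" "i < k" "j < k"
  shows "(bidiag_mat k d e * A) $$ (i, j)
    = d * A $$ (i, j) + (if Suc i < k then e * A $$ (Suc i, j) else 0)"
proof -
  have "(bidiag_mat k d e * A) $$ (i, j) = (\<Sum>l = 0..<k. bidiag_mat k d e $$ (i, l) * A $$ (l, j))"
    using assms by (simp add: scalar_prod_def)
  also have "\<dots> = (\<Sum>l = 0..<k. (if l = i then d * A $$ (l, j) else 0)
      + (if l = Suc i then e * A $$ (l, j) else 0))"
    using assms by (intro sum.cong) (auto simp: bidiag_mat_def)
  finally show ?thesis
    using assms by (simp add: sum.distrib)
qed

text \<open>Row \<open>i\<close> lists the coefficients of the power series of \<open>(c x / (1 + a x)) ^ i\<close>.\<close>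

fun series_coeff :: "'a::comm_ring_1 \<Rightarrow> 'a \<Rightarrow> nat \<Rightarrow> nat \<Rightarrow> 'a" where
  "series_coeff c a 0 j = (if j = 0 then 1 else 0)"
| "series_coeff c a (Suc i) 0 = 0"
| "series_coeff c a (Suc i) (Suc j) = c * series_coeff c a i j - a * series_coeff c a (Suc i) j"

text \<open>The \<open>i\<close>-th power of \<open>c x / (1 + a x)\<close> has lowest term
  \<open>c ^ i * x ^ i\<close>, so the array of coefficients is upper triangular with powers of
  \<open>c\<close> on the diagonal.\<close>

lemma series_coeff_below: "j < i \<Longrightarrow> series_coeff c a i j = 0"
  by (induction c a i j rule: series_coeff.induct) auto

lemma series_coeff_diag: "series_coeff c a i i = c ^ i"
  by (induction i) (auto simp: series_coeff_below)

text \<open>Read row \<open>i\<close> of \<open>Q\<close> as the series \<open>f ^ i\<close> modulo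
  \<open>x ^ k\<close>. Multiplying by the shift on the right multiplies by \<open>x\<close>, on the
  left by \<open>f\<close>. The equation becomes \<open>(\<mu> + f) (1 + a x) = \<mu> + x\<close>,
  whose solution is \<open>f = c x / (1 + a x)\<close> with \<open>c = 1 - \<mu> * a\<close>. The
  hypothesis makes \<open>c\<close> nonzero and hence \<open>Q\<close> invertible.\<close>

lemma jordan_block_similarity:
  fixes \<mu> a :: "'a::field"
  assumes "1 - \<mu> * a \<noteq> 0"
  obtains Q where "Q \<in> carrier_mat k k" "invertible_mat Q"
    "jordan_block k \<mu> * (Q * bidiag_mat k 1 a) = Q * jordan_block k \<mu>"
proof -
  define q where "q = series_coeff (1 - \<mu> * a) a"
  define Q where "Q = mat k k (\<lambda>(i, j). q i j)"
  have Q: "Q \<in> carrier_mat k k"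
    by (simp add: Q_def)
  have "invertible_mat Q"
    using assms by (intro invertible_upper_triangular[OF Q])
      (auto simp: Q_def q_def series_coeff_below series_coeff_diag)
  moreover have "jordan_block k \<mu> * (Q * bidiag_mat k 1 a) = Q * jordan_block k \<mu>"
  proof (rule eq_matI)
    fix i j assume "i < dim_row (Q * jordan_block k \<mu>)" "j < dim_col (Q * jordan_block k \<mu>)"
    then have ij: "i < k" "j < k"
      by (auto simp: Q_def)
    \<comment> \<open>In the last row the shift yields 0 instead of \<open>f ^ k\<close>; the two
      agree modulo \<open>x ^ k\<close>.\<close>
    have last: "q (Suc i) l = 0" if "\<not> Suc i < k" "l \<le> j" for l
      using that ij by (simp add: q_def series_coeff_below)
    show "(jordan_block k \<mu> * (Q * bidiag_mat k 1 a)) $$ (i, j) = (Q * jordan_block k \<mu>) $$ (i, j)"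
      \<comment> \<open>Column 0 has no left neighbour; in the other columns the identity is the
        recursion of \<open>series_coeff\<close> together with
        \<open>\<mu> * a + c = 1\<close>.\<close>
      unfolding jordan_block_eq_bidiag_mat using Q ij last[of j] last[of "j - 1"]
      by (cases j; simp add: index_bidiag_mat_mult index_mult_bidiag_mat del: index_mult_mat)
        (auto simp: Q_def q_def algebra_simps)
  qed (auto simp: Q_def bidiag_mat_def)
  ultimately show thesis
    using that Q by blast
qed

text \<open>The target is \<open>T_mat (2 * k) \<mu>\<close> with the even indices listed before the
  odd ones.\<close>

lemma star_congruent_H_mat_block:
  assumes "cmod \<mu> > 1"
  shows "star_congruent (2 * k) (H_mat k \<mu>) (four_block_mat (0\<^sub>m k k)
    (mat_adjoint (bidiag_mat k 1 (cnj \<mu>))) (jordan_block k \<mu>) (0\<^sub>m k k))"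
proof -
  define B where "B = bidiag_mat k 1 (cnj \<mu>)"
  define J where "J = jordan_block k \<mu>"
  have B: "B \<in> carrier_mat k k" and J: "J \<in> carrier_mat k k"
    by (auto simp: B_def J_def)
  have "invertible_mat B"
    by (intro invertible_upper_triangular[OF B]) (auto simp: B_def bidiag_mat_def)
  \<comment> \<open>This is the condition of \<open>jordan_block_similarity\<close> for
    \<open>a = cnj \<mu>\<close>; the number equals 1 minus the squared modulus of \<mu>.\<close>
  have "1 - \<mu> * cnj \<mu> \<noteq> 0"
  proof
    assume "1 - \<mu> * cnj \<mu> = 0"
    then have "complex_of_real ((cmod \<mu>)\<^sup>2) = complex_of_real 1"
      by (simp only: complex_norm_square) simp
    then have "(cmod \<mu>)\<^sup>2 = 1"
      by (simp only: of_real_eq_iff)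
    with assms show False
      by (simp add: power2_eq_1_iff)
  qed
  then obtain Q where Q: "Q \<in> carrier_mat k k" "invertible_mat Q" "J * (Q * B) = Q * J"
    unfolding B_def J_def by (rule jordan_block_similarity)
  obtain Y where Y: "Y \<in> carrier_mat k k" "Y * Q = 1\<^sub>m k"
    using invertible_matE[OF Q(2,1)] by blast
  have QB: "Q * B \<in> carrier_mat k k"
    using Q B by simp
  then have QB_adj: "mat_adjoint (Q * B) \<in> carrier_mat k k"
    by simp
  have "invertible_mat (Q * B)"
    using Q B \<open>invertible_mat B\<close> by (intro invertible_mat_mult) auto
  then obtain R where R: "R \<in> carrier_mat k k" "R * (Q * B) = 1\<^sub>m k"
    using invertible_matE QB by blast
  \<comment> \<open>A block diagonal matrix with blocks \<open>X\<close> and \<open>Y\<close> turns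
    the off-diagonal blocks of \<open>H_mat\<close> into \<open>X * mat_adjoint Y\<close> and
    \<open>Y * J * mat_adjoint X\<close>. With \<open>Y\<close> inverse to \<open>Q\<close>, the
    first is \<open>mat_adjoint B\<close> for \<open>X = mat_adjoint (Q * B)\<close>, and then
    \<open>J * (Q * B) = Q * J\<close> makes the second equal to \<open>J\<close>.\<close>
  define S where "S = four_block_mat (mat_adjoint (Q * B)) (0\<^sub>m k k) (0\<^sub>m k k) Y"
  have S: "S \<in> carrier_mat (k + k) (k + k)"
    unfolding S_def using QB Y by (intro four_block_carrier_mat) auto
  have S_adj: "mat_adjoint S = four_block_mat (Q * B) (0\<^sub>m k k) (0\<^sub>m k k) (mat_adjoint Y)"
    unfolding S_def using QB Y by (subst mat_adjoint_four_block_diag) auto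
  have "mat_adjoint (Q * B) * mat_adjoint R = 1\<^sub>m k"
    using R QB mat_adjoint_mult[of R k k "Q * B" k] by simp
  then have "S * four_block_mat (mat_adjoint R) (0\<^sub>m k k) (0\<^sub>m k k) Q
      = four_block_mat (1\<^sub>m k) (0\<^sub>m k k) (0\<^sub>m k k) (1\<^sub>m k)"
    unfolding S_def using QB Q Y R by (subst mult_four_block_mat[of _ k k _ k _ k _ _ k _ k]) auto
  then have inv: "invertible_mat S"
    using S R Q by (intro invertible_matI[OF S, of "four_block_mat (mat_adjoint R) (0\<^sub>m k k) (0\<^sub>m k k) Q"])
      auto
  have "mat_adjoint (Q * B) * mat_adjoint Y = mat_adjoint (Y * (Q * B))"
    using Y QB by (simp add: mat_adjoint_mult)
  also have "Y * (Q * B) = (Y * Q) * B"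
    using Y Q B by (intro assoc_mult_mat[symmetric]) auto
  finally have upper: "mat_adjoint (Q * B) * mat_adjoint Y = mat_adjoint B"
    using Y B by simp
  have "Y * J * (Q * B) = Y * (J * (Q * B))"
    using Y Q J B by (intro assoc_mult_mat) auto
  also have "\<dots> = Y * Q * J"
    unfolding Q(3) using Y Q J by (intro assoc_mult_mat[symmetric]) auto
  finally have lower: "Y * J * (Q * B) = J"
    using Y J by simp
  have "S * H_mat k \<mu> = four_block_mat (0\<^sub>m k k) (mat_adjoint (Q * B)) (Y * J) (0\<^sub>m k k)"
    unfolding S_def H_mat_def J_def[symmetric] using QB QB_adj Y J
    by (subst mult_four_block_mat[of _ k k _ k _ k _ _ k _ k])
      (auto simp: right_mult_zero_mat[OF QB_adj] right_mult_one_mat[OF QB_adj]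
        right_add_zero_mat[OF QB_adj])
  then have "S * H_mat k \<mu> * mat_adjoint S
      = four_block_mat (0\<^sub>m k k) (mat_adjoint B) J (0\<^sub>m k k)"
    unfolding S_adj using QB QB_adj Y J
    by (simp, subst mult_four_block_mat[of _ k k _ k _ k _ _ k _ k])
      (auto simp: upper lower left_mult_zero_mat[OF QB] right_mult_zero_mat[OF QB_adj]
        left_add_zero_mat[OF mat_adjoint_carrier[OF B]])
  then show ?thesis
    using S inv B J unfolding star_congruent_def B_def J_def H_mat_def
    by (auto simp: mult_2)
qed

lemma star_congruent_H_mat_T_mat:
  assumes "cmod \<mu> > 1"
  shows "star_congruent (2 * k) (H_mat k \<mu>) (T_mat (2 * k) \<mu>)"
proof -
  define M where "M = four_block_mat (0\<^sub>m k k)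
    (mat_adjoint (bidiag_mat k 1 (cnj \<mu>))) (jordan_block k \<mu>) (0\<^sub>m k k)"
  \<comment> \<open>Position \<open>2 * a\<close> reads index \<open>a\<close> of the first block,
    position \<open>2 * a + 1\<close> reads index \<open>a\<close> of the second.\<close>
  define p where "p i = (if even i then i div 2 else k + i div 2)" for i
  have M: "M \<in> carrier_mat (2 * k) (2 * k)"
    unfolding M_def mult_2 by (intro four_block_carrier_mat) auto
  have "bij_betw p {..<2 * k} {..<2 * k}"
    by (rule bij_betw_lessThanI) (auto simp: p_def split: if_splits elim!: evenE oddE)
  then have "star_congruent (2 * k) M (mat (2 * k) (2 * k) (\<lambda>(i, j). M $$ (p i, p j)))"
    by (rule star_congruent_permutation[OF M])
  moreover have "mat (2 * k) (2 * k) (\<lambda>(i, j). M $$ (p i, p j)) = T_mat (2 * k) \<mu>"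
  proof (rule eq_matI)
    fix i j assume "i < dim_row (T_mat (2 * k) \<mu>)" "j < dim_col (T_mat (2 * k) \<mu>)"
    then have ij: "i < 2 * k" "j < 2 * k"
      by (auto simp: T_mat_def)
    define a b where "a = i div 2" and "b = j div 2"
    have ab: "a < k" "b < k"
      using ij by (auto simp: a_def b_def)
    \<comment> \<open>Positions of equal parity are never adjacent, which matches the zero diagonal
      blocks of \<open>M\<close>.\<close>
    have parity: "2 * x \<noteq> Suc (2 * y)" for x y :: nat
      by presburger
    have "i = 2 * a \<or> i = Suc (2 * a)" "j = 2 * b \<or> j = Suc (2 * b)"
      unfolding a_def b_def by arith+
    then consider "i = 2 * a" "j = 2 * b" | "i = 2 * a" "j = Suc (2 * b)"
      | "i = Suc (2 * a)" "j = 2 * b" | "i = Suc (2 * a)" "j = Suc (2 * b)"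
      by blast
    then show "mat (2 * k) (2 * k) (\<lambda>(i, j). M $$ (p i, p j)) $$ (i, j)
        = T_mat (2 * k) \<mu> $$ (i, j)"
    proof cases
      case 1
      with ab show ?thesis
        by (simp add: T_mat_def p_def M_def parity)
    next
      \<comment> \<open>The lower bidiagonal block \<open>mat_adjoint B\<close>: its diagonal
        supplies superdiagonal ones, its subdiagonal the value
        \<open>cnj (cnj \<mu>) = \<mu>\<close>.\<close>
      case 2
      with ab show ?thesis
        by (simp add: T_mat_def p_def M_def bidiag_mat_def)
    next
      \<comment> \<open>The Jordan block: here the diagonal supplies the subdiagonal entries \<mu>
        and the superdiagonal the ones.\<close>
      case 3
      with ab show ?thesis
        by (simp add: T_mat_def p_def M_def)
    next
      case 4
      with ab show ?thesis
        by (simp add: T_mat_def p_def M_def parity)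
    qed
  qed (auto simp: T_mat_def)
  ultimately show ?thesis
    using star_congruent_trans star_congruent_H_mat_block[OF assms] unfolding M_def by metis
qed

section \<open>The three congruences together\<close>

theorem theorem3p2:
  fixes k :: nat
  assumes "k \<ge> 1"
  shows "star_congruent k (jordan_block k 0) (T_mat k 0)
    \<and> (\<forall>\<mu>::complex. cmod \<mu> = 1 \<longrightarrow>
          (k mod 4 \<in> {1, 2} \<longrightarrow>
             star_congruent k (\<mu> \<cdot>\<^sub>m Gamma_mat k) (\<mu> \<cdot>\<^sub>m Gamma_tilde_mat k)) \<and>
          (k mod 4 \<in> {0, 3} \<longrightarrow>
             star_congruent k (\<mu> \<cdot>\<^sub>m Gamma_mat k) (- \<mu> \<cdot>\<^sub>m Gamma_tilde_mat k)))
    \<and> (\<forall>\<mu>::complex. cmod \<mu> > 1 \<longrightarrow>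
          star_congruent (2 * k) (H_mat k \<mu>) (T_mat (2 * k) \<mu>))"
proof (intro conjI allI impI)
  show "star_congruent k (jordan_block k 0) (T_mat k 0)"
    unfolding jordan_block_zero_eq_T_mat by (intro star_congruent_refl) (simp add: T_mat_def)
next
  fix \<mu> :: complex
  assume "k mod 4 \<in> {1, 2}"
  then have "even (k - 1 - k div 2)"
    using even_sign_exponent_iff[OF assms] by simp
  then show "star_congruent k (\<mu> \<cdot>\<^sub>m Gamma_mat k) (\<mu> \<cdot>\<^sub>m Gamma_tilde_mat k)"
    using star_congruent_smult[OF star_congruent_Gamma_mat[OF assms], of \<mu>]
    by (simp add: smult_smult_mat)
next
  fix \<mu> :: complex
  assume "k mod 4 \<in> {0, 3}"
  \<comment> \<open>An odd exponent makes the scalar -1, which is absorbed into the factor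
    \<mu>.\<close>
  then have "odd (k - 1 - k div 2)"
    using even_sign_exponent_iff[OF assms] by auto
  then show "star_congruent k (\<mu> \<cdot>\<^sub>m Gamma_mat k) (- \<mu> \<cdot>\<^sub>m Gamma_tilde_mat k)"
    using star_congruent_smult[OF star_congruent_Gamma_mat[OF assms], of \<mu>]
    by (simp add: smult_smult_mat)
next
  fix \<mu> :: complex
  assume "cmod \<mu> > 1"
  then show "star_congruent (2 * k) (H_mat k \<mu>) (T_mat (2 * k) \<mu>)"
    by (rule star_congruent_H_mat_T_mat)
qed

end
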